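(* Let $T\in\mathbb{R}^{n\times n}$ be irreducible and $b\in\mathbb{R}^n$, and consider the iteration $$P^0=O,\qquad (I-P^k+TP^k)\,x^{k+1}=b,\qquad P^{k+1}=P(x^{k+1}),\qquad k=0,1,\dots .$$ Assume that either $T$ satisfies property (T1), or $T$ satisfies property (T2) and $v^Tb\le 0$. Then the iteration converges in at most $n$ steps: there exists $k\in\{0,1,\dots,n\}$ such that $x^1,\dots,x^{k+1}$ are well defined (all the matrices $I-P^j+TP^j$, $0\le j\le k$, being nonsingular), the exit condition $(P^{k+1}-P^k)x^{k+1}=0$ holds, and $x^{k+1}$ is an exact solution of $$[\,I-P(x)+TP(x)\,]\,x=b.$$
   Context: For $x\in\mathbb{R}^n$, $P(x)$ is the diagonal matrix $\mathrm{diag}(p(x_1),\dots,p(x_n))$ with $p(x_i)=1$ if $x_i\ge 0$ and $p(x_i)=0$ otherwise. The superscript $k$ is an iteration index, not a power; note that $x^1=b$. All inequalities between vectors or matrices are componentwise; $O$ is the zero matrix. An $M$-matrix is a real square matrix that can be written as $\alpha I-B$ with $B\ge O$ and spectral radius $\rho(B)<\alpha$. Property (T1): $T$ is an $M$-matrix. Property (T2): $\mathrm{null}(T^T)=\mathrm{span}(v)$ and $\mathrm{null}(T)=\mathrm{span}(w)$ for some vectors $v,w>0$ (componentwise), and $T+D$ is an $M$-matrix for every diagonal matrix $D\ge O$ with $D\ne O$. The vector $v$ in the claim is the one in (T2). *)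

theory Defs
  imports
    "Jordan_Normal_Form.Matrix_Kernel"
    "Jordan_Normal_Form.Spectral_Radius"
    "HOL-Combinatorics.Permutations"
begin

definition pos_vec :: "nat \<Rightarrow> real vec \<Rightarrow> bool" where
  "pos_vec n v \<longleftrightarrow> v \<in> carrier_vec n \<and> (\<forall>i<n. 0 < v $ i)"
  \<comment> \<open>The library's \<open><\<close> on vectors only means \<open>\<le>\<close> and \<open>\<noteq>\<close>, so it cannot be used here.\<close>

text \<open>
  \<open>A\<close> is reducible if a simultaneous permutation of its rows and columns gives it the block form
  \<open>[[B, C], [0, D]]\<close> with \<open>B\<close> square of size \<open>r\<close>, where \<open>0 < r < n\<close>.
  In particular, every \<open>1 \<times> 1\<close> matrix is irreducible, including the zero matrix.
\<close>

definition irreducible_mat :: "nat \<Rightarrow> real mat \<Rightarrow> bool" where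
  "irreducible_mat n A \<longleftrightarrow>
     \<not> (\<exists>p r. p permutes {..<n} \<and> 0 < r \<and> r < n \<and>
          (\<forall>i j. r \<le> i \<and> i < n \<and> j < r \<longrightarrow> A $$ (p i, p j) = 0))"

definition M_matrix :: "nat \<Rightarrow> real mat \<Rightarrow> bool" where
  "M_matrix n A \<longleftrightarrow>
     (\<exists>\<alpha> B. B \<in> carrier_mat n n \<and> 0\<^sub>m n n \<le> B \<and> A = \<alpha> \<cdot>\<^sub>m 1\<^sub>m n - B \<and>
            spectral_radius (map_mat complex_of_real B) < \<alpha>)"

abbreviation real_span :: "nat \<Rightarrow> real vec set \<Rightarrow> real vec set" where
  "real_span n \<equiv> LinearCombinations.module.span class_ring (module_vec TYPE(real) n)"

definition property_T1 :: "nat \<Rightarrow> real mat \<Rightarrow> bool" where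
  "property_T1 n T \<longleftrightarrow> M_matrix n T"

definition property_T2 :: "nat \<Rightarrow> real mat \<Rightarrow> real vec \<Rightarrow> bool" where
  "property_T2 n T v \<longleftrightarrow>
     pos_vec n v \<and> mat_kernel (transpose_mat T) = real_span n {v} \<and>
     (\<exists>w. pos_vec n w \<and> mat_kernel T = real_span n {w}) \<and>
     (\<forall>D. D \<in> carrier_mat n n \<and> diagonal_mat D \<and> 0\<^sub>m n n \<le> D \<and> D \<noteq> 0\<^sub>m n n
          \<longrightarrow> M_matrix n (T + D))"

definition P_mat :: "real vec \<Rightarrow> real mat" where
  "P_mat x = mat_diag (dim_vec x) (\<lambda>i. if 0 \<le> x $ i then 1 else 0)"

definition system_mat :: "nat \<Rightarrow> real mat \<Rightarrow> real mat \<Rightarrow> real mat" where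
  "system_mat n T P = 1\<^sub>m n - P + T * P"

text \<open>
  The sequences \<open>P\<close> and \<open>x\<close> follow the iteration for the steps \<open>0, \<dots>, k\<close>; only
  \<open>P 0, \<dots>, P (k + 1)\<close> and \<open>x 1, \<dots>, x (k + 1)\<close> are constrained.  They are well defined,
  i.e. uniquely determined, when all \<open>system_mat n T (P j)\<close> with \<open>j \<le> k\<close> are nonsingular.
\<close>

definition iteration_upto ::
  "nat \<Rightarrow> real mat \<Rightarrow> real vec \<Rightarrow> nat \<Rightarrow> (nat \<Rightarrow> real mat) \<Rightarrow> (nat \<Rightarrow> real vec) \<Rightarrow> bool" where
  "iteration_upto n T b k P x \<longleftrightarrow>
     P 0 = 0\<^sub>m n n \<and>
     (\<forall>j\<le>k. x (Suc j) \<in> carrier_vec n \<and>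
            system_mat n T (P j) *\<^sub>v x (Suc j) = b \<and>
            P (Suc j) = P_mat (x (Suc j)))"

end

theory Submission
  imports Defs
begin

text \<open>
  The iteration is a statement about sets of indices.  Writing \<open>P = indicator_mat n S\<close>, the system
  \<open>(I - P + T P) x = b\<close> says that the part of \<open>x\<close> on \<open>S\<close> solves the principal subsystem of \<open>T\<close>
  with index set \<open>S\<close>, and that each remaining component is what is missing from \<open>b\<close>:
  \<open>x\<^sub>i = b\<^sub>i - (T z)\<^sub>i\<close> for \<open>i \<notin> S\<close>, where \<open>z\<close> is \<open>x\<close> set to zero off \<open>S\<close>.  The next index set \<open>S'\<close>
  consists of the \<open>i\<close> with \<open>x\<^sub>i \<ge> 0\<close>.

  The index sets increase.  Suppose \<open>x \<ge> 0\<close> on \<open>S\<close>, as is trivially the case for the initial \<open>S = {}\<close>.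
  Then \<open>S \<subseteq> S'\<close>, and \<open>T z \<le> b\<close> on \<open>S'\<close>, with equality on \<open>S\<close> and a gap of exactly \<open>x\<^sub>i\<close> elsewhere.  The
  next solution solves the subsystem on \<open>S'\<close> exactly, so if principal subsystems of \<open>T\<close> are inverse
  positive it dominates \<open>z\<close> on \<open>S'\<close> and is again nonnegative there (\<open>next_solution_nonneg\<close>).  A strictly
  increasing chain of subsets of an \<open>n\<close>-element set has at most \<open>n\<close> steps, and as soon as \<open>S' = S\<close> the
  current iterate solves the nonlinear equation.

  Inverse positivity of all principal subsystems of an M-matrix \<open>\<alpha> I - B\<close> comes from the negative part
  \<open>m\<close> of a vector \<open>u\<close>: where \<open>u\<close> is negative and its image is not, \<open>\<alpha> m \<le> B m\<close>; this forces
  \<open>m = 0\<close>, since the powers of \<open>B\<close> grow more slowly than those of \<open>\<alpha>\<close>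
  (\<open>spectral_radius_less_subinvariant_zero\<close>).

  Under (T2) only the proper index sets have inverse positive subsystems, because there a diagonal entry
  outside \<open>S\<close> may be increased at no cost.  The full set is harmless: if \<open>S'\<close> is everything, then
  \<open>T z \<le> b\<close> everywhere, and \<open>v\<^sup>T T = 0\<close>, \<open>v\<^sup>T b \<le> 0\<close> and \<open>v > 0\<close> turn this into
  \<open>T z = b\<close>.  Hence \<open>x\<close> vanishes off \<open>S\<close> and the exit condition already holds before the singular
  matrix could be used (\<open>T2_full_nonneg_set_exit\<close>).
\<close>

section \<open>Linear systems\<close>

lemma mult_mat_vec_index_sum:
  fixes A :: "'a :: semiring_0 mat"
  assumes "A \<in> carrier_mat m n" "u \<in> carrier_vec n" "i < m"
  shows "(A *\<^sub>v u) $ i = (\<Sum>j<n. A $$ (i, j) * u $ j)"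
  using assms by (auto simp: scalar_prod_def lessThan_atLeast0 intro!: sum.cong)

lemma invertible_mat_if_trivial_kernel:
  fixes A :: "'a :: field mat"
  assumes A: "A \<in> carrier_mat n n"
    and inj: "\<And>x. x \<in> carrier_vec n \<Longrightarrow> A *\<^sub>v x = 0\<^sub>v n \<Longrightarrow> x = 0\<^sub>v n"
  shows "invertible_mat A"
proof -
  have "det A \<noteq> 0"
    using det_0_iff_vec_prod_zero_field[OF A] inj by blast
  from det_non_zero_imp_unit[OF A this, of "()"]
  show ?thesis
    using A by (auto simp: Units_def ring_mat_def invertible_mat_def inverts_mat_def)
qed

lemma invertible_mat_solvable:
  fixes A :: "'a :: comm_ring_1 mat"
  assumes A: "A \<in> carrier_mat n n" and inv: "invertible_mat A" and b: "b \<in> carrier_vec n"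
  shows "\<exists>x \<in> carrier_vec n. A *\<^sub>v x = b"
proof -
  from inv obtain B where AB: "inverts_mat A B" and BA: "inverts_mat B A"
    unfolding invertible_mat_def by blast
  have B: "B \<in> carrier_mat n n"
    using AB BA A unfolding inverts_mat_def
    by (metis carrier_matD(1,2) carrier_mat_triv index_mult_mat(3) index_one_mat(3))
  have "A *\<^sub>v (B *\<^sub>v b) = (A * B) *\<^sub>v b" using A B b by simp
  also have "\<dots> = b" using AB A b unfolding inverts_mat_def by simp
  finally show ?thesis using B b by (intro bexI[of _ "B *\<^sub>v b"]) auto
qed

section \<open>Inverse positivity of M-matrices\<close>

lemma spectral_radius_smult_less_1:
  fixes A :: "complex mat"
  assumes A: "A \<in> carrier_mat n n" and n: "0 < n"
    and sr: "spectral_radius A < \<beta>"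
  shows "spectral_radius (complex_of_real (1 / \<beta>) \<cdot>\<^sub>m A) < 1"
proof -
  obtain ev0 where "ev0 \<in> spectrum A" "spectral_radius A = norm ev0"
    using spectral_radius_mem_max(1)[OF A n] by auto
  then have \<beta>: "0 < \<beta>" using sr norm_ge_zero[of ev0] by linarith
  let ?A = "complex_of_real (1 / \<beta>) \<cdot>\<^sub>m A"
  have A': "?A \<in> carrier_mat n n" using A by simp
  obtain ev where ev: "ev \<in> spectrum ?A" and r: "spectral_radius ?A = norm ev"
    using spectral_radius_mem_max(1)[OF A' n] by auto
  from ev obtain u where u: "u \<in> carrier_vec n" "u \<noteq> 0\<^sub>v n" "?A *\<^sub>v u = ev \<cdot>\<^sub>v u"
    using A unfolding spectrum_def eigenvalue_def eigenvector_def by auto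
  have "A *\<^sub>v u = complex_of_real \<beta> \<cdot>\<^sub>v (?A *\<^sub>v u)"
    using A u(1) \<beta> by (intro eq_vecI) auto
  also have "\<dots> = (complex_of_real \<beta> * ev) \<cdot>\<^sub>v u"
    unfolding u(3) by (simp add: smult_smult_assoc)
  finally have "complex_of_real \<beta> * ev \<in> spectrum A"
    using A u unfolding spectrum_def eigenvalue_def eigenvector_def by auto
  then have "norm (complex_of_real \<beta> * ev) \<le> spectral_radius A"
    by (intro spectral_radius_mem_max(2)[OF A n]) auto
  then have "\<beta> * norm ev < \<beta> * 1" using sr \<beta> unfolding norm_mult norm_of_real by linarith
  then show ?thesis unfolding r using \<beta> by (simp only: mult_less_cancel_left_pos)
qed

text \<open>
  Because \<open>B\<close> is nonnegative, multiplying the inequality \<open>t m \<le> B m\<close> by a power of \<open>B\<close> preserves it.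
  Nonnegativity of the powers is part of the statement so that both facts go through one induction.
\<close>

lemma pow_mat_subinvariant:
  fixes B :: "real mat"
  assumes B: "B \<in> carrier_mat n n" and nonneg: "0\<^sub>m n n \<le> B"
    and m: "m \<in> carrier_vec n" and t: "0 \<le> t"
    and sub: "\<And>i. i < n \<Longrightarrow> t * m $ i \<le> (B *\<^sub>v m) $ i"
  shows "0\<^sub>m n n \<le> B ^\<^sub>m k \<and> (\<forall>i<n. t ^ k * m $ i \<le> (B ^\<^sub>m k *\<^sub>v m) $ i)"
proof (induction k)
  case 0
  show ?case using B m by (auto simp: less_eq_mat_def)
next
  case (Suc k)
  have Bk: "B ^\<^sub>m k \<in> carrier_mat n n" using B by simp
  have pos: "0 \<le> (B ^\<^sub>m k) $$ (i, j)" "0 \<le> B $$ (i, j)" if "i < n" "j < n" for i j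
    using Suc.IH nonneg B Bk that by (auto simp: less_eq_mat_def)
  have "0\<^sub>m n n \<le> B ^\<^sub>m Suc k"
    using B Bk pos by (auto simp: less_eq_mat_def scalar_prod_def intro!: sum_nonneg)
  moreover have "t ^ Suc k * m $ i \<le> (B ^\<^sub>m Suc k *\<^sub>v m) $ i" if i: "i < n" for i
  proof -
    have "t ^ Suc k * m $ i = t * (t ^ k * m $ i)" by simp
    also have "\<dots> \<le> t * (B ^\<^sub>m k *\<^sub>v m) $ i"
      using Suc.IH i t by (intro mult_left_mono) auto
    also have "\<dots> = (\<Sum>j<n. (B ^\<^sub>m k) $$ (i, j) * (t * m $ j))"
      by (subst mult_mat_vec_index_sum[OF Bk m i]) (simp add: sum_distrib_left ac_simps)
    also have "\<dots> \<le> (\<Sum>j<n. (B ^\<^sub>m k) $$ (i, j) * (B *\<^sub>v m) $ j)"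
      using sub pos i by (intro sum_mono mult_left_mono) auto
    also have "\<dots> = (B ^\<^sub>m k *\<^sub>v (B *\<^sub>v m)) $ i"
      using B m by (subst mult_mat_vec_index_sum[OF Bk _ i]) auto
    also have "B ^\<^sub>m k *\<^sub>v (B *\<^sub>v m) = B ^\<^sub>m Suc k *\<^sub>v m"
      using B Bk m by (simp add: assoc_mult_mat_vec[of _ n n _ n])
    finally show ?thesis .
  qed
  ultimately show ?case by blast
qed

text \<open>
  A growth argument replaces the nonnegative eigenvector of Perron-Frobenius theory.  Choose \<open>\<beta>\<close> strictly between the spectral radius and \<open>\<alpha>\<close>.  The Jordan normal form bounds
  the powers of \<open>B / \<beta>\<close>, whereas a nonzero \<open>m\<close> would make them grow at least like \<open>(\<alpha> / \<beta>)\<^sup>k\<close>.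
\<close>

lemma spectral_radius_less_subinvariant_zero:
  fixes B :: "real mat"
  assumes B: "B \<in> carrier_mat n n" and nonneg: "0\<^sub>m n n \<le> B"
    and sr: "spectral_radius (map_mat complex_of_real B) < \<alpha>"
    and m: "m \<in> carrier_vec n" and m0: "\<And>i. i < n \<Longrightarrow> 0 \<le> m $ i"
    and sub: "\<And>i. i < n \<Longrightarrow> \<alpha> * m $ i \<le> (B *\<^sub>v m) $ i"
    and i: "i < n"
  shows "m $ i = 0"
proof (rule ccontr)
  assume "m $ i \<noteq> 0"
  then have mi: "0 < m $ i" using m0[OF i] by simp
  have n: "0 < n" using i by simp
  have CB: "map_mat complex_of_real B \<in> carrier_mat n n" using B by simp
  obtain \<beta> where \<beta>: "spectral_radius (map_mat complex_of_real B) < \<beta>" "\<beta> < \<alpha>"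
    using dense[OF sr] by blast
  obtain ev0 :: complex where "spectral_radius (map_mat complex_of_real B) = norm ev0"
    using spectral_radius_mem_max(1)[OF CB n] by auto
  then have \<beta>0: "0 < \<beta>" using \<beta> norm_ge_zero[of ev0] by linarith
  define C where "C = (1 / \<beta>) \<cdot>\<^sub>m B"
  have C: "C \<in> carrier_mat n n" using B by (simp add: C_def)
  have "map_mat complex_of_real C = complex_of_real (1 / \<beta>) \<cdot>\<^sub>m map_mat complex_of_real B"
    unfolding C_def by (intro eq_matI) auto
  then have "spectral_radius (map_mat complex_of_real C) < 1"
    using spectral_radius_smult_less_1[OF CB n \<beta>(1)] by simp
  then obtain c where "\<And>k. norm_bound (map_mat complex_of_real C ^\<^sub>m k) c"
    using spectral_radius_jnf_norm_bound_less_1_upper_triangular[of "map_mat complex_of_real C" n] C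
    by auto
  then have bound: "\<bar>(C ^\<^sub>m k) $$ (i, j)\<bar> \<le> c" if "j < n" for j k
    using that i C unfolding of_real_hom.mat_hom_pow[OF C, symmetric] norm_bound_def
    by (metis carrier_matD(1,2) index_map_mat(1,2,3) norm_of_real pow_carrier_mat)
  have C0: "0\<^sub>m n n \<le> C" using nonneg B \<beta>0 by (auto simp: C_def less_eq_mat_def)
  have subC: "\<alpha> / \<beta> * m $ j \<le> (C *\<^sub>v m) $ j" if "j < n" for j
    using sub[OF that] that B m \<beta>0 by (simp add: C_def field_simps)
  have low: "(\<alpha> / \<beta>) ^ k * m $ i \<le> c * (\<Sum>j<n. m $ j)" for k
  proof -
    have "(\<alpha> / \<beta>) ^ k * m $ i \<le> (C ^\<^sub>m k *\<^sub>v m) $ i"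
      using pow_mat_subinvariant[OF C C0 m _ subC] \<beta> \<beta>0 i by auto
    also have "\<dots> = (\<Sum>j<n. (C ^\<^sub>m k) $$ (i, j) * m $ j)"
      using C by (intro mult_mat_vec_index_sum[OF _ m i]) auto
    also have "\<dots> \<le> (\<Sum>j<n. c * m $ j)"
      using bound m0 by (intro sum_mono mult_right_mono) (auto intro: order_trans[OF abs_ge_self])
    finally show ?thesis by (simp add: sum_distrib_left)
  qed
  have "1 < \<alpha> / \<beta>" using \<beta> \<beta>0 by simp
  from real_arch_pow[OF this, of "c * (\<Sum>j<n. m $ j) / m $ i"]
  obtain k where "c * (\<Sum>j<n. m $ j) / m $ i < (\<alpha> / \<beta>) ^ k" by blast
  then have "c * (\<Sum>j<n. m $ j) < (\<alpha> / \<beta>) ^ k * m $ i" using mi by (simp add: field_simps)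
  with low[of k] show False by simp
qed

text \<open>
  Asking for a nonnegative image only where \<open>u\<close> is negative gives all principal submatrices at
  once: for a vector that vanishes off \<open>S\<close>, nothing need be known about its image off \<open>S\<close>.
\<close>

lemma M_matrix_nonneg:
  assumes M: "M_matrix n A" and u: "u \<in> carrier_vec n"
    and neg: "\<And>i. i < n \<Longrightarrow> u $ i < 0 \<Longrightarrow> 0 \<le> (A *\<^sub>v u) $ i"
    and i: "i < n"
  shows "0 \<le> u $ i"
proof -
  from M obtain \<alpha> B where B: "B \<in> carrier_mat n n" and B0: "0\<^sub>m n n \<le> B"
    and A: "A = \<alpha> \<cdot>\<^sub>m 1\<^sub>m n - B"
    and sr: "spectral_radius (map_mat complex_of_real B) < \<alpha>"
    unfolding M_matrix_def by blast
  have pos: "0 \<le> B $$ (i, j)" if "i < n" "j < n" for i j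
    using B0 B that by (auto simp: less_eq_mat_def)
  define m where "m = Matrix.vec n (\<lambda>i. max 0 (- u $ i))"
  have m: "m \<in> carrier_vec n" by (simp add: m_def)
  have "m $ i = 0"
  proof (rule spectral_radius_less_subinvariant_zero[OF B B0 sr m _ _ i])
    fix j assume j: "j < n"
    show "0 \<le> m $ j" using j by (simp add: m_def)
    have Bm: "(B *\<^sub>v m) $ j = (\<Sum>l<n. B $$ (j, l) * max 0 (- u $ l))"
      by (subst mult_mat_vec_index_sum[OF B m j]) (auto simp: m_def)
    show "\<alpha> * m $ j \<le> (B *\<^sub>v m) $ j"
    proof (cases "u $ j < 0")
      case True
      have "(A *\<^sub>v u) $ j = \<alpha> * u $ j - (B *\<^sub>v u) $ j"
        using B u j by (simp add: A minus_mult_distrib_mat_vec[of _ n n])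
      then have "\<alpha> * (- u $ j) \<le> - (B *\<^sub>v u) $ j" using neg[OF j True] by simp
      also have "\<dots> = (\<Sum>l<n. B $$ (j, l) * (- u $ l))"
        by (subst mult_mat_vec_index_sum[OF B u j]) (simp add: sum_negf)
      also have "\<dots> \<le> (B *\<^sub>v m) $ j"
        unfolding Bm using pos j by (intro sum_mono mult_left_mono) auto
      finally show ?thesis using True j by (simp add: m_def)
    next
      case False
      have "0 \<le> (B *\<^sub>v m) $ j"
        unfolding Bm using pos j by (intro sum_nonneg mult_nonneg_nonneg) auto
      then show ?thesis using False j by (simp add: m_def)
    qed
  qed
  then show ?thesis using i by (simp add: m_def)
qed

section \<open>Index sets whose principal submatrix is inverse positive\<close>

text \<open>
  The principal submatrix on \<open>S\<close> is inverse positive.  It is described through vectors of full length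
  supported on \<open>S\<close>, so that submatrices of different sizes need not be formed or compared.
\<close>

definition inverse_positive_on :: "nat \<Rightarrow> real mat \<Rightarrow> nat set \<Rightarrow> bool" where
  "inverse_positive_on n T S \<longleftrightarrow>
     (\<forall>u \<in> carrier_vec n. (\<forall>i<n. i \<notin> S \<longrightarrow> u $ i = 0) \<longrightarrow>
        (\<forall>i<n. i \<in> S \<longrightarrow> 0 \<le> (T *\<^sub>v u) $ i) \<longrightarrow> (\<forall>i<n. 0 \<le> u $ i))"

lemma inverse_positive_onD:
  assumes "inverse_positive_on n T S" "u \<in> carrier_vec n"
    and "\<And>i. i < n \<Longrightarrow> i \<notin> S \<Longrightarrow> u $ i = 0"
    and "\<And>i. i < n \<Longrightarrow> i \<in> S \<Longrightarrow> 0 \<le> (T *\<^sub>v u) $ i"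
    and "i < n"
  shows "0 \<le> u $ i"
  using assms unfolding inverse_positive_on_def by blast

lemma M_matrix_inverse_positive_on:
  assumes "M_matrix n T"
  shows "inverse_positive_on n T S"
  unfolding inverse_positive_on_def
proof (intro ballI impI allI)
  fix u i
  assume u: "u \<in> carrier_vec n" "\<forall>i<n. i \<notin> S \<longrightarrow> u $ i = 0"
    "\<forall>i<n. i \<in> S \<longrightarrow> 0 \<le> (T *\<^sub>v u) $ i" and i: "i < n"
  show "0 \<le> u $ i"
    by (rule M_matrix_nonneg[OF assms u(1) _ i]) (use u in force)
qed

text \<open>
  Adding \<open>1\<close> to the diagonal entry of \<open>T\<close> at an index \<open>l \<notin> S\<close> gives an M-matrix and does not change the
  product with vectors supported on \<open>S\<close>.
\<close>

lemma property_T2_inverse_positive_on: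
  assumes T2: "property_T2 n T v" and T: "T \<in> carrier_mat n n"
    and l: "l < n" "l \<notin> S"
  shows "inverse_positive_on n T S"
proof -
  define D :: "real mat" where "D = mat_diag n (\<lambda>i. if i = l then 1 else 0)"
  have D: "D \<in> carrier_mat n n" by (simp add: D_def)
  have "D $$ (l, l) \<noteq> 0\<^sub>m n n $$ (l, l)" using l by (simp add: D_def mat_diag_def)
  then have "D \<noteq> 0\<^sub>m n n" by metis
  moreover have "diagonal_mat D" "0\<^sub>m n n \<le> D"
    by (auto simp: D_def mat_diag_def diagonal_mat_def less_eq_mat_def)
  ultimately have "M_matrix n (T + D)"
    using T2 D unfolding property_T2_def by blast
  then have ip: "inverse_positive_on n (T + D) S"
    by (rule M_matrix_inverse_positive_on)
  have "(T + D) *\<^sub>v u = T *\<^sub>v u" if u: "u \<in> carrier_vec n" "u $ l = 0" for u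
  proof -
    have "D *\<^sub>v u = 0\<^sub>v n"
    proof (rule eq_vecI)
      fix i assume i: "i < dim_vec (0\<^sub>v n :: real vec)"
      then have "(D *\<^sub>v u) $ i = (\<Sum>j<n. D $$ (i, j) * u $ j)"
        by (intro mult_mat_vec_index_sum[OF D u(1)]) simp
      also have "\<dots> = 0"
        using i u(2) by (intro sum.neutral) (auto simp: D_def mat_diag_def)
      finally show "(D *\<^sub>v u) $ i = 0\<^sub>v n $ i" using i by simp
    qed (use D in simp)
    then show ?thesis using T D u by (simp add: add_mult_distrib_mat_vec[of _ n n])
  qed
  then show ?thesis using ip l unfolding inverse_positive_on_def by metis
qed

section \<open>One step of the iteration\<close>

definition indicator_mat :: "nat \<Rightarrow> nat set \<Rightarrow> real mat" where
  "indicator_mat n S = mat_diag n (\<lambda>i. if i \<in> S then 1 else 0)"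

definition restrict_vec :: "nat \<Rightarrow> nat set \<Rightarrow> real vec \<Rightarrow> real vec" where
  "restrict_vec n S x = Matrix.vec n (\<lambda>i. if i \<in> S then x $ i else 0)"

definition nonneg_set :: "nat \<Rightarrow> real vec \<Rightarrow> nat set" where
  "nonneg_set n x = {i. i < n \<and> 0 \<le> x $ i}"

lemma indicator_mat_carrier [simp]: "indicator_mat n S \<in> carrier_mat n n"
  by (simp add: indicator_mat_def)

lemma restrict_vec_carrier [simp]: "restrict_vec n S x \<in> carrier_vec n"
  by (simp add: restrict_vec_def)

lemma indicator_mat_mult_vec:
  assumes "x \<in> carrier_vec n"
  shows "indicator_mat n S *\<^sub>v x = restrict_vec n S x"
proof (rule eq_vecI)
  fix i assume "i < dim_vec (restrict_vec n S x)"
  then have i: "i < n" by (simp add: restrict_vec_def)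
  have "(indicator_mat n S *\<^sub>v x) $ i = (\<Sum>j<n. indicator_mat n S $$ (i, j) * x $ j)"
    by (rule mult_mat_vec_index_sum[OF indicator_mat_carrier assms i])
  also have "\<dots> = (\<Sum>j<n. if j = i then (if i \<in> S then x $ i else 0) else 0)"
    using i by (intro sum.cong) (auto simp: indicator_mat_def mat_diag_def)
  also have "\<dots> = restrict_vec n S x $ i" using i by (simp add: restrict_vec_def)
  finally show "(indicator_mat n S *\<^sub>v x) $ i = restrict_vec n S x $ i" .
qed (simp add: indicator_mat_def mat_diag_def restrict_vec_def)

lemma P_mat_eq_indicator_mat:
  assumes "x \<in> carrier_vec n"
  shows "P_mat x = indicator_mat n (nonneg_set n x)"
  using assms
  by (intro eq_matI) (auto simp: P_mat_def indicator_mat_def nonneg_set_def mat_diag_def)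

lemma indicator_mat_empty: "indicator_mat n {} = 0\<^sub>m n n"
  by (intro eq_matI) (auto simp: indicator_mat_def mat_diag_def)

lemma system_mat_carrier [simp]:
  "T \<in> carrier_mat n n \<Longrightarrow> system_mat n T (indicator_mat n S) \<in> carrier_mat n n"
  by (simp add: system_mat_def)

lemma system_mat_mult_vec:
  assumes T: "T \<in> carrier_mat n n" and x: "x \<in> carrier_vec n"
  shows "system_mat n T (indicator_mat n S) *\<^sub>v x
    = x - restrict_vec n S x + T *\<^sub>v restrict_vec n S x"
proof -
  let ?P = "indicator_mat n S"
  have "(1\<^sub>m n - ?P + T * ?P) *\<^sub>v x = (1\<^sub>m n - ?P) *\<^sub>v x + (T * ?P) *\<^sub>v x"
    using T x by (intro add_mult_distrib_mat_vec[of _ n n] minus_carrier_mat) auto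
  also have "(1\<^sub>m n - ?P) *\<^sub>v x = x - ?P *\<^sub>v x"
    using x by (simp add: minus_mult_distrib_mat_vec[of _ n n])
  also have "(T * ?P) *\<^sub>v x = T *\<^sub>v (?P *\<^sub>v x)"
    using T x by (intro assoc_mult_mat_vec[of _ n n _ n]) auto
  finally show ?thesis unfolding system_mat_def indicator_mat_mult_vec[OF x] .
qed

text \<open>
  Componentwise form of the linear system: on \<open>S\<close> it is the principal subsystem of \<open>T\<close>, and off \<open>S\<close>
  it expresses \<open>x\<close> explicitly.
\<close>

lemma system_solution_index:
  assumes T: "T \<in> carrier_mat n n" and x: "x \<in> carrier_vec n"
    and eq: "system_mat n T (indicator_mat n S) *\<^sub>v x = b" and i: "i < n"
  shows "b $ i = (if i \<in> S then 0 else x $ i) + (T *\<^sub>v restrict_vec n S x) $ i"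
  using T x i unfolding eq[symmetric] system_mat_mult_vec[OF T x]
  by (auto simp: restrict_vec_def)

text \<open>
  If \<open>x\<close> solves the homogeneous system, inverse positivity applies both to the part of \<open>x\<close> on \<open>S\<close>
  and to its negative, so that part is zero; the remaining components are then zero as well.
\<close>

lemma system_mat_invertible:
  assumes ip: "inverse_positive_on n T S" and T: "T \<in> carrier_mat n n"
  shows "invertible_mat (system_mat n T (indicator_mat n S))"
proof (rule invertible_mat_if_trivial_kernel)
  fix x assume x: "x \<in> carrier_vec n"
    and "system_mat n T (indicator_mat n S) *\<^sub>v x = 0\<^sub>v n"
  note eq = system_solution_index[OF T this]
  let ?u = "restrict_vec n S x"
  have u: "(T *\<^sub>v ?u) $ i = 0" if "i < n" "i \<in> S" for i
    using eq[OF that(1)] that by simp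
  have minus: "(T *\<^sub>v (- ?u)) $ i = - (T *\<^sub>v ?u) $ i" if "i < n" for i
    using T that by (simp add: mult_mat_vec_index_sum[of _ n n] restrict_vec_def sum_negf)
  have "?u $ i = 0" if i: "i < n" for i
  proof (rule antisym)
    have "0 \<le> (- ?u) $ i"
      by (rule inverse_positive_onD[OF ip _ _ _ i]) (auto simp: u minus, auto simp: restrict_vec_def)
    then show "?u $ i \<le> 0" using i by (simp add: restrict_vec_def)
    show "0 \<le> ?u $ i"
      by (rule inverse_positive_onD[OF ip _ _ _ i]) (auto simp: u, auto simp: restrict_vec_def)
  qed
  then have u0: "?u = 0\<^sub>v n" by (intro eq_vecI) (auto simp: restrict_vec_def)
  have "(T *\<^sub>v ?u) $ i = 0" if "i < n" for i
    unfolding u0 using T that by simp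
  moreover have "x $ i = 0" if "i < n" "i \<in> S" for i
    using arg_cong[OF u0, of "\<lambda>u. u $ i"] that by (simp add: restrict_vec_def)
  ultimately have "x $ i = 0" if "i < n" for i
    using eq[OF that] that by (cases "i \<in> S") auto
  then show "x = 0\<^sub>v n" using x by (intro eq_vecI) auto
qed (use T in simp)

text \<open>
  The residual at \<open>i\<close> is zero for \<open>i \<in> S\<close> and equal to \<open>x $ i\<close> otherwise.
\<close>

lemma restricted_solution_subsolution:
  assumes T: "T \<in> carrier_mat n n" and x: "x \<in> carrier_vec n"
    and eq: "system_mat n T (indicator_mat n S) *\<^sub>v x = b"
    and i: "i \<in> S \<union> nonneg_set n x" "i < n"
  shows "(T *\<^sub>v restrict_vec n S x) $ i \<le> b $ i"
  using system_solution_index[OF T x eq i(2)] i by (auto simp: nonneg_set_def split: if_splits)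

text \<open>
  The old solution, cut off outside \<open>S\<close>, is a nonnegative subsolution of the new subsystem, so the
  new solution dominates it.
\<close>

lemma next_solution_nonneg:
  assumes T: "T \<in> carrier_mat n n" and x: "x \<in> carrier_vec n" and y: "y \<in> carrier_vec n"
    and eq: "system_mat n T (indicator_mat n S) *\<^sub>v x = b"
    and S: "S \<subseteq> nonneg_set n x"
    and ip: "inverse_positive_on n T (nonneg_set n x)"
    and eq': "system_mat n T (indicator_mat n (nonneg_set n x)) *\<^sub>v y = b"
  shows "nonneg_set n x \<subseteq> nonneg_set n y"
proof
  fix i assume iS: "i \<in> nonneg_set n x"
  then have i: "i < n" by (simp add: nonneg_set_def)
  let ?z = "restrict_vec n S x" and ?w = "restrict_vec n (nonneg_set n x) y"
  have "0 \<le> (?w - ?z) $ i"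
  proof (rule inverse_positive_onD[OF ip _ _ _ i])
    fix j assume j: "j < n"
    {
      assume "j \<notin> nonneg_set n x"
      then show "(?w - ?z) $ j = 0" using j S by (auto simp: restrict_vec_def)
    next
      assume jS: "j \<in> nonneg_set n x"
      have "(T *\<^sub>v ?z) $ j \<le> b $ j"
        using restricted_solution_subsolution[OF T x eq _ j] jS by blast
      also have "b $ j = (T *\<^sub>v ?w) $ j"
        using system_solution_index[OF T y eq' j] jS by simp
      finally show "0 \<le> (T *\<^sub>v (?w - ?z)) $ j"
        using T j by (simp add: mult_minus_distrib_mat_vec[of _ n n])
    }
  qed simp
  moreover have "0 \<le> ?z $ i" using i S by (auto simp: restrict_vec_def nonneg_set_def)
  ultimately show "i \<in> nonneg_set n y"
    using i iS by (auto simp: nonneg_set_def restrict_vec_def split: if_splits)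
qed

text \<open>
  All residuals \<open>b $ i - (T z) $ i\<close>, where \<open>z\<close> is the part of \<open>x\<close> on \<open>S\<close>, are nonnegative.  Their
  combination with the positive weights \<open>v\<close> equals \<open>v \<bullet> b \<le> 0\<close>, since \<open>v\<close> annihilates the range of
  \<open>T\<close>.  Therefore each residual is zero, and off \<open>S\<close> the residuals are the components of \<open>x\<close>.
\<close>

lemma T2_full_nonneg_set_exit:
  assumes T2: "property_T2 n T v" and vb: "v \<bullet> b \<le> 0"
    and T: "T \<in> carrier_mat n n" and x: "x \<in> carrier_vec n" and b: "b \<in> carrier_vec n"
    and eq: "system_mat n T (indicator_mat n S) *\<^sub>v x = b"
    and full: "nonneg_set n x = {..<n}"
    and i: "i < n" "i \<notin> S"
  shows "x $ i = 0"
proof -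
  have v: "v \<in> carrier_vec n" and v0: "\<And>j. j < n \<Longrightarrow> 0 < v $ j"
    using T2 by (auto simp: property_T2_def pos_vec_def)
  interpret vec_space "TYPE(real)" n .
  have "v \<in> span {v}" using v by (intro span_mem) auto
  then have Tv: "T\<^sup>T *\<^sub>v v = 0\<^sub>v n"
    using T2 T by (auto simp: property_T2_def mat_kernel_def)
  let ?z = "restrict_vec n S x"
  have "v \<bullet> (T *\<^sub>v ?z) = (T\<^sup>T *\<^sub>v v) \<bullet> ?z"
    using T v by (simp add: transpose_vec_mult_scalar)
  also have "\<dots> = 0" unfolding Tv by simp
  finally have vTz: "v \<bullet> (T *\<^sub>v ?z) = 0" .
  have "(\<Sum>j<n. v $ j * (b $ j - (T *\<^sub>v ?z) $ j)) = v \<bullet> b - v \<bullet> (T *\<^sub>v ?z)"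
    using T b v by (simp add: scalar_prod_def lessThan_atLeast0 right_diff_distrib sum_subtractf)
  also have "\<dots> \<le> 0" using vb vTz by simp
  finally have le: "(\<Sum>j<n. v $ j * (b $ j - (T *\<^sub>v ?z) $ j)) \<le> 0" .
  have nn: "0 \<le> v $ j * (b $ j - (T *\<^sub>v ?z) $ j)" if "j < n" for j
    using restricted_solution_subsolution[OF T x eq _ that] full v0[OF that] that by auto
  have "v $ i * (b $ i - (T *\<^sub>v ?z) $ i) \<le> (\<Sum>j<n. v $ j * (b $ j - (T *\<^sub>v ?z) $ j))"
    using i nn by (intro member_le_sum) auto
  with le nn[OF i(1)] have "v $ i * (b $ i - (T *\<^sub>v ?z) $ i) = 0" by linarith
  then show ?thesis using system_solution_index[OF T x eq i(1)] i v0[of i] by simp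
qed

section \<open>Finite termination\<close>

text \<open>
  The invariant is required to survive only those steps at which the process does not stop: under (T2)
  the set after the last step may be the full set, for which the linear system is singular.
\<close>

lemma increasing_subsets_stop:
  fixes S :: "nat \<Rightarrow> nat set"
  assumes init: "Inv (S 0)"
    and step: "\<And>j. Inv (S j) \<Longrightarrow> \<not> stop j \<Longrightarrow> Inv (S (Suc j)) \<and> S j \<subset> S (Suc j)"
    and bound: "\<And>A. Inv A \<Longrightarrow> A \<subseteq> {..<n}"
  shows "\<exists>k\<le>n. stop k \<and> (\<forall>j\<le>k. Inv (S j))"
proof -
  have *: "Inv (S j) \<and> j \<le> card (S j)" if "\<And>l. l < j \<Longrightarrow> \<not> stop l" for j
    using that
  proof (induction j)
    case (Suc j)
    then have IH: "Inv (S j)" "j \<le> card (S j)" by auto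
    note st = step[OF IH(1) Suc.prems[OF lessI]]
    have "finite (S (Suc j))" using bound[of "S (Suc j)"] st finite_subset by blast
    then have "card (S j) < card (S (Suc j))" using st psubset_card_mono by blast
    then show ?case using st IH(2) by simp
  qed (use init in simp)
  have "\<exists>k. k \<le> n \<and> stop k"
  proof (rule ccontr)
    assume "\<not> ?thesis"
    then have "Inv (S (Suc n)) \<and> Suc n \<le> card (S (Suc n))" by (intro *) auto
    moreover have "card (S (Suc n)) \<le> n" if "Inv (S (Suc n))"
      using card_mono[OF _ bound[OF that]] by simp
    ultimately show False by simp
  qed
  then obtain k where k: "k \<le> n \<and> stop k" and least: "\<And>l. l < k \<Longrightarrow> \<not> (l \<le> n \<and> stop l)"
    using exists_least_iff[of "\<lambda>k. k \<le> n \<and> stop k"] by blast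
  have "Inv (S j)" if "j \<le> k" for j
    using * [of j] least k that by auto
  then show ?thesis using k by blast
qed

theorem corollary9:
  fixes n :: nat and T :: "real mat" and b :: "real vec"
  assumes "0 < n"
    and "T \<in> carrier_mat n n"
    and "b \<in> carrier_vec n"
    and "irreducible_mat n T"
    and "property_T1 n T \<or> (\<exists>v. property_T2 n T v \<and> v \<bullet> b \<le> 0)"
  shows "\<exists>k\<le>n. \<exists>P x.
           iteration_upto n T b k P x \<and>
           (\<forall>j\<le>k. invertible_mat (system_mat n T (P j))) \<and>
           (P (Suc k) - P k) *\<^sub>v x (Suc k) = 0\<^sub>v n \<and>
           system_mat n T (P_mat (x (Suc k))) *\<^sub>v x (Suc k) = b"
proof -
  note T = assms(2) and b = assms(3)
  let ?A = "\<lambda>S. system_mat n T (indicator_mat n S)"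
  define sol where "sol S = (SOME x. x \<in> carrier_vec n \<and> ?A S *\<^sub>v x = b)" for S
  define next_set where "next_set S = nonneg_set n (sol S)" for S
  define S where "S j = (next_set ^^ j) {}" for j :: nat
  define stop where "stop j \<longleftrightarrow> (\<forall>i \<in> S (Suc j) - S j. sol (S j) $ i = 0)" for j
  \<comment> \<open>\<open>A \<subseteq> next_set A\<close> says that the solution belonging to \<open>A\<close> is nonnegative on \<open>A\<close>.\<close>
  define Inv where "Inv A \<longleftrightarrow> A \<subseteq> next_set A \<and> inverse_positive_on n T A" for A
  have S_Suc: "S (Suc j) = nonneg_set n (sol (S j))" for j by (simp add: S_def next_set_def)
  have sol: "sol A \<in> carrier_vec n" "?A A *\<^sub>v sol A = b" if "inverse_positive_on n T A" for A
  proof -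
    have "\<exists>x. x \<in> carrier_vec n \<and> ?A A *\<^sub>v x = b"
      using invertible_mat_solvable[OF system_mat_carrier[OF T] system_mat_invertible[OF that T] b]
      by blast
    from someI_ex[OF this, folded sol_def]
    show "sol A \<in> carrier_vec n" "?A A *\<^sub>v sol A = b" by auto
  qed
  have "\<exists>k\<le>n. stop k \<and> (\<forall>j\<le>k. Inv (S j))"
  proof (rule increasing_subsets_stop)
    have "inverse_positive_on n T {}"
      unfolding inverse_positive_on_def by auto
    then show "Inv (S 0)" by (simp add: Inv_def S_def)
  next
    fix A assume "Inv A"
    then show "A \<subseteq> {..<n}" by (auto simp: Inv_def next_set_def nonneg_set_def)
  next
    fix j assume "Inv (S j)" and nstop: "\<not> stop j"
    then have sub: "S j \<subseteq> S (Suc j)" and ip: "inverse_positive_on n T (S j)"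
      by (auto simp: Inv_def S_def)
    note x = sol[OF ip]
    from nstop have "S j \<noteq> S (Suc j)" unfolding stop_def by auto
    have ip': "inverse_positive_on n T (S (Suc j))"
      using assms(5)
    proof
      assume "property_T1 n T"
      then show ?thesis
        unfolding property_T1_def by (rule M_matrix_inverse_positive_on)
    next
      assume "\<exists>v. property_T2 n T v \<and> v \<bullet> b \<le> 0"
      then obtain v where T2: "property_T2 n T v" and vb: "v \<bullet> b \<le> 0" by blast
      have "S (Suc j) \<noteq> {..<n}"
      proof
        assume full: "S (Suc j) = {..<n}"
        have "sol (S j) $ i = 0" if "i < n" "i \<notin> S j" for i
          using T2_full_nonneg_set_exit[OF T2 vb T x(1) b x(2) _ that] full
          unfolding S_Suc by blast
        then have "stop j" unfolding stop_def full by auto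
        with nstop show False by blast
      qed
      moreover have "S (Suc j) \<subseteq> {..<n}" by (auto simp: S_Suc nonneg_set_def)
      ultimately obtain l where "l < n" "l \<notin> S (Suc j)" by auto
      then show ?thesis by (rule property_T2_inverse_positive_on[OF T2 T])
    qed
    have "S (Suc j) \<subseteq> S (Suc (Suc j))"
      using next_solution_nonneg[OF T x(1) _ x(2)] sub ip' sol[OF ip'] unfolding S_Suc by blast
    then have "Inv (S (Suc j))" using ip' by (simp add: Inv_def S_def)
    then show "Inv (S (Suc j)) \<and> S j \<subset> S (Suc j)" using sub \<open>S j \<noteq> S (Suc j)\<close> by blast
  qed
  then obtain k where k: "k \<le> n" "stop k" and inv: "\<And>j. j \<le> k \<Longrightarrow> Inv (S j)" by blast
  define P where "P j = indicator_mat n (S j)" for j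
  \<comment> \<open>The iterates start at index 1; the value \<open>x 0\<close> is arbitrary.\<close>
  define x where "x j = sol (S (j - 1))" for j
  have ip: "inverse_positive_on n T (S j)" if "j \<le> k" for j
    using inv[OF that] by (simp add: Inv_def)
  have x: "x (Suc j) \<in> carrier_vec n" "system_mat n T (P j) *\<^sub>v x (Suc j) = b"
    "P (Suc j) = P_mat (x (Suc j))" if "j \<le> k" for j
    using sol[OF ip[OF that]] by (simp_all add: x_def P_def S_Suc P_mat_eq_indicator_mat)
  have "P 0 = 0\<^sub>m n n" by (simp add: P_def S_def indicator_mat_empty)
  then have iter: "iteration_upto n T b k P x"
    using x unfolding iteration_upto_def by auto
  have inver: "\<forall>j\<le>k. invertible_mat (system_mat n T (P j))"
    unfolding P_def using system_mat_invertible[OF ip T] by blast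
  have sub: "S k \<subseteq> S (Suc k)" using inv[of k] by (simp add: Inv_def S_def)
  \<comment> \<open>The exit condition makes the last two index sets indistinguishable for this iterate.\<close>
  have res: "restrict_vec n (S (Suc k)) (x (Suc k)) = restrict_vec n (S k) (x (Suc k))"
    using k(2) sub by (intro eq_vecI) (auto simp: restrict_vec_def stop_def x_def)
  note xk = x[OF order_refl]
  have "(P (Suc k) - P k) *\<^sub>v x (Suc k) = P (Suc k) *\<^sub>v x (Suc k) - P k *\<^sub>v x (Suc k)"
    using xk(1) by (intro minus_mult_distrib_mat_vec[of _ n n]) (auto simp: P_def)
  also have "\<dots> = 0\<^sub>v n"
    unfolding P_def indicator_mat_mult_vec[OF xk(1)] res by simp
  finally have ex: "(P (Suc k) - P k) *\<^sub>v x (Suc k) = 0\<^sub>v n" .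
  have "system_mat n T (P_mat (x (Suc k))) *\<^sub>v x (Suc k) = b"
    using xk(2) unfolding xk(3)[symmetric] P_def system_mat_mult_vec[OF T xk(1)] res .
  then show ?thesis using k(1) iter inver ex by blast
qed

end
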